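(* Let $X$ be a Tychonoff semitopological locally convex semilattice such that for each $x\in X$ the lower cone ${\downarrow}x$ is pseudocompact and the multiplication restricted to ${\downarrow}x$, i.e. the map ${\downarrow}x\times{\downarrow}x\to{\downarrow}x$, $(a,b)\mapsto ab$, is quasicontinuous. Then the multiplication $X\times X\to X$ is continuous at each point of the diagonal $\{(x,x):x\in X\}$ of $X\times X$.
   Context: A semilattice is a commutative semigroup in which every element is idempotent ($xx=x$); it carries the natural partial order $x\le y \iff xy=x$, and ${\downarrow}x=\{y\in X: y\le x\}$. A semitopological semilattice is a semilattice endowed with a topology such that the multiplication is separately continuous (continuous in each variable when the other is fixed). A subset $A$ of a poset is convex if $a,b\in A$ and $a\le c\le b$ imply $c\in A$; a poset with a topology is locally convex if its topology has a base of convex sets; for a semilattice this refers to the natural order. A space is pseudocompact if every real-valued continuous function on it is bounded. A function $f : A\to B$ between topological spaces is quasicontinuous if for every $a\in A$, every open $V\subset B$ with $f(a)\in V$ and every open $U\subset A$ with $a\in U$ there is a nonempty open $W\subset U$ with $f(W)\subset V$. *)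

theory Defs
  imports "HOL-Analysis.Analysis"
begin

definition natural_le :: "('a \<Rightarrow> 'a \<Rightarrow> 'a) \<Rightarrow> 'a \<Rightarrow> 'a \<Rightarrow> bool" where
  "natural_le mul x y \<longleftrightarrow> mul y x = x"

definition lower_cone :: "('a \<Rightarrow> 'a \<Rightarrow> 'a) \<Rightarrow> 'a \<Rightarrow> 'a set" where
  "lower_cone mul x = {y. natural_le mul y x}"

text \<open>Order convexity; the library's \<^const>\<open>convex\<close> is convexity in real vector spaces.\<close>

definition order_convex :: "('a \<Rightarrow> 'a \<Rightarrow> bool) \<Rightarrow> 'a set \<Rightarrow> bool" where
  "order_convex le A \<longleftrightarrow> (\<forall>a\<in>A. \<forall>b\<in>A. \<forall>c. le a c \<and> le c b \<longrightarrow> c \<in> A)"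

definition locally_order_convex :: "('a::topological_space \<Rightarrow> 'a \<Rightarrow> bool) \<Rightarrow> bool" where
  "locally_order_convex le \<longleftrightarrow>
     (\<exists>B. topological_basis B \<and> (\<forall>A\<in>B. order_convex le A))"

locale semitopological_semilattice = semilattice mul
  for mul :: "'a::topological_space \<Rightarrow> 'a \<Rightarrow> 'a" +
  assumes continuous_left: "continuous_on UNIV (\<lambda>x. mul a x)"
    and continuous_right: "continuous_on UNIV (\<lambda>x. mul x a)"

text \<open>The library's \<^const>\<open>completely_regular_space\<close> includes no separation axiom.\<close>

definition tychonoff_space :: "'a topology \<Rightarrow> bool" where
  "tychonoff_space X \<longleftrightarrow> completely_regular_space X \<and> Hausdorff_space X"

definition pseudocompact_space :: "'a topology \<Rightarrow> bool" where
  "pseudocompact_space X \<longleftrightarrow>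
     (\<forall>f::'a \<Rightarrow> real. continuous_map X euclideanreal f \<longrightarrow> bounded (f ` topspace X))"

definition quasicontinuous_map :: "'a topology \<Rightarrow> 'b topology \<Rightarrow> ('a \<Rightarrow> 'b) \<Rightarrow> bool" where
  "quasicontinuous_map X Y f \<longleftrightarrow>
     f \<in> topspace X \<rightarrow> topspace Y \<and>
     (\<forall>a\<in>topspace X. \<forall>V U. openin Y V \<and> f a \<in> V \<and> openin X U \<and> a \<in> U \<longrightarrow>
        (\<exists>W. openin X W \<and> W \<noteq> {} \<and> W \<subseteq> U \<and> f ` W \<subseteq> V))"

end

theory Submission
  imports Defs
begin

text \<open>Local convexity reduces the claim to continuity at \<open>(x, x)\<close> within the lower
  cone of \<open>x\<close>, whose unit is \<open>x\<close>: one has \<open>xab \<le> ab \<le> a\<close>, so \<open>ab\<close> lies in a convex neighbourhood as soon as \<open>a\<close> and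
  \<open>(xa)(xb)\<close> do. If continuity failed in the cone, quasicontinuity would yield
  nonempty open sets \<open>S n\<close>, \<open>T m\<close> and a continuous real function that is small on the products
  \<open>S n T m\<close> for \<open>n < m\<close> and large for \<open>m \<le> n\<close>. In a pseudocompact space both sequences of
  open sets have cluster points, and at these the two iterated limits contradict each other.\<close>

section \<open>General topology: pseudocompactness and quasicontinuity\<close>

text \<open>Without a cluster point the sequence \<open>S n\<close> would be locally finite. Bump
  functions living in the sets \<open>S n\<close>, weighted by \<open>n\<close>, would then sum to a
  continuous unbounded function.\<close>

lemma pseudocompact_open_sequence_cluster:
  assumes cr: "completely_regular_space X" and pc: "pseudocompact_space X"
    and op: "\<And>n::nat. openin X (S n)" and ne: "\<And>n. S n \<noteq> {}"
  obtains p where "p \<in> topspace X"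
    and "\<And>W k. openin X W \<Longrightarrow> p \<in> W \<Longrightarrow> \<exists>n\<ge>k. W \<inter> S n \<noteq> {}"
proof (rule ccontr)
  assume contra: "\<not> thesis"
  have locfin: "\<exists>W k. openin X W \<and> p \<in> W \<and> (\<forall>n\<ge>k. W \<inter> S n = {})" if "p \<in> topspace X" for p
    using contra that \<open>\<And>p. \<lbrakk>p \<in> topspace X; \<And>W k. \<lbrakk>openin X W; p \<in> W\<rbrakk> \<Longrightarrow> \<exists>n\<ge>k. W \<inter> S n \<noteq> {}\<rbrakk> \<Longrightarrow> thesis\<close>
    by metis
  have "\<exists>x. x \<in> S n" for n using ne by blast
  then obtain x where x: "\<And>n. x n \<in> S n" by metis
  have xX: "x n \<in> topspace X" for n using x op openin_subset by blast
  have "\<exists>f. continuous_map X euclideanreal f \<and> f (x n) = 1 \<and> (\<forall>y\<in>topspace X. 0 \<le> f y)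
          \<and> (\<forall>y\<in>topspace X - S n. f y = 0)" for n
  proof -
    have "closedin X (topspace X - S n)" "x n \<in> topspace X - (topspace X - S n)"
      using op x xX by (auto simp: closedin_def Diff_Diff_Int openin_subset Int_absorb1)
    then obtain f where f: "continuous_map X (top_of_set {0..1::real}) f" "f (x n) = 0"
        "f ` (topspace X - S n) \<subseteq> {1}"
      using cr unfolding completely_regular_space_def by blast
    have f1: "continuous_map X euclideanreal f" and f2: "f \<in> topspace X \<rightarrow> {0..1}"
      using f(1) by (auto simp: continuous_map_in_subtopology)
    have "continuous_map X euclideanreal (\<lambda>y. 1 - f y)"
      using f1 by (intro continuous_intros) auto
    then show ?thesis using f f2
      by (intro exI[of _ "\<lambda>y. 1 - f y"]) fastforce
  qed
  then obtain f where f: "\<And>n. continuous_map X euclideanreal (f n)" "\<And>n. f n (x n) = (1::real)"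
      "\<And>n y. y \<in> topspace X \<Longrightarrow> 0 \<le> f n y" "\<And>n y. y \<in> topspace X - S n \<Longrightarrow> f n y = 0"
    by metis
  \<comment> \<open>Near every point all but finitely many terms vanish, so locally \<open>F\<close>
    is one fixed finite sum of continuous functions. The weight \<open>n\<close> forces
    \<open>F (x n)\<close> to be at least \<open>n\<close>.\<close>
  define F where "F y = (\<Sum>n. real n * f n y)" for y
  have fin: "\<exists>W k. openin X W \<and> p \<in> W \<and> (\<forall>y\<in>W. \<forall>n\<ge>k. f n y = 0)" if p: "p \<in> topspace X" for p
  proof -
    obtain W k where W: "openin X W" "p \<in> W" "\<forall>n\<ge>k. W \<inter> S n = {}"
      using locfin[OF p] by blast
    then have "\<forall>y\<in>W. \<forall>n\<ge>k. f n y = 0"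
      using f(4) openin_subset by (metis Diff_iff disjoint_iff subsetD)
    then show ?thesis using W by blast
  qed
  have Feq: "F y = (\<Sum>n<k. real n * f n y)" if "\<forall>n\<ge>k. f n y = 0" for y k
    unfolding F_def by (rule suminf_finite) (use that in \<open>auto simp: not_less\<close>)
  have "continuous_map X euclideanreal F"
  proof -
    have "topcontinuous_at X euclideanreal F p" if p: "p \<in> topspace X" for p
    proof -
      obtain W k where W: "openin X W" "p \<in> W" "\<forall>y\<in>W. \<forall>n\<ge>k. f n y = 0"
        using fin[OF p] by blast
      have c: "continuous_map X euclideanreal (\<lambda>y. \<Sum>n<k. real n * f n y)"
        by (intro continuous_intros f) auto
      have eq: "F y = (\<Sum>n<k. real n * f n y)" if "y \<in> W" for y
        using W that Feq by blast
      show ?thesis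
        unfolding topcontinuous_at_def
      proof (intro conjI allI impI)
        fix V assume V: "openin euclideanreal V \<and> F p \<in> V"
        let ?U = "W \<inter> {y \<in> topspace X. (\<Sum>n<k. real n * f n y) \<in> V}"
        have "openin X ?U"
          using W c V by (intro openin_Int openin_continuous_map_preimage) auto
        moreover have "p \<in> ?U" using W p V eq by auto
        moreover have "\<forall>y\<in>?U. F y \<in> V" using eq by auto
        ultimately show "\<exists>U. openin X U \<and> p \<in> U \<and> (\<forall>y\<in>U. F y \<in> V)" by blast
      qed (use p in auto)
    qed
    then show ?thesis by (simp add: continuous_map_eq_topcontinuous_at)
  qed
  then have "bounded (F ` topspace X)" using pc by (simp add: pseudocompact_space_def)
  then obtain B where B: "\<And>y. y \<in> topspace X \<Longrightarrow> \<bar>F y\<bar> \<le> B"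
    by (auto simp: bounded_iff)
  obtain m :: nat where m: "B < m" using reals_Archimedean2 by blast
  obtain k where k: "\<forall>n\<ge>k. f n (x m) = 0" using fin[OF xX] by blast
  \<comment> \<open>Since \<open>f m (x m) = 1\<close>, the index \<open>m\<close> lies below the
    cutoff \<open>k\<close>, so the term \<open>m\<close> really occurs in the finite sum.\<close>
  have "m < k" using k f(2)[of m] by (metis not_less zero_neq_one)
  then have "real m * f m (x m) \<le> (\<Sum>n<k. real n * f n (x m))"
    by (intro member_le_sum) (auto simp: f(3) xX)
  also have "\<dots> = F (x m)" using Feq k by simp
  finally show False using B[OF xX, of m] m f(2)[of m] by simp
qed

text \<open>A double limit argument at a pair \<open>(s, t)\<close> of cluster points. Letting
  \<open>y\<close> approach \<open>t\<close> first and then \<open>x\<close> approach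
  \<open>s\<close> gives \<open>f s t \<le> c\<close>; the opposite order gives
  \<open>d \<le> f s t\<close>. Each passage uses continuity in one variable only.\<close>

lemma pseudocompact_double_limit:
  fixes f :: "'a \<Rightarrow> 'b \<Rightarrow> real"
  assumes X: "completely_regular_space X" "pseudocompact_space X"
    and Y: "completely_regular_space Y" "pseudocompact_space Y"
    and contX: "\<And>y. y \<in> topspace Y \<Longrightarrow> continuous_map X euclideanreal (\<lambda>x. f x y)"
    and contY: "\<And>x. x \<in> topspace X \<Longrightarrow> continuous_map Y euclideanreal (f x)"
    and S: "\<And>n::nat. openin X (S n)" "\<And>n. S n \<noteq> {}"
    and T: "\<And>n::nat. openin Y (T n)" "\<And>n. T n \<noteq> {}"
    and lo: "\<And>n m x y. n < m \<Longrightarrow> x \<in> S n \<Longrightarrow> y \<in> T m \<Longrightarrow> f x y \<le> c"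
    and hi: "\<And>n m x y. m \<le> n \<Longrightarrow> x \<in> S n \<Longrightarrow> y \<in> T m \<Longrightarrow> d \<le> f x y"
  shows "d \<le> c"
proof -
  obtain s where s: "s \<in> topspace X"
      "\<And>W k. openin X W \<Longrightarrow> s \<in> W \<Longrightarrow> \<exists>n\<ge>k. W \<inter> S n \<noteq> {}"
    using pseudocompact_open_sequence_cluster[OF X, of S] S by metis
  obtain t where t: "t \<in> topspace Y"
      "\<And>W k. openin Y W \<Longrightarrow> t \<in> W \<Longrightarrow> \<exists>n\<ge>k. W \<inter> T n \<noteq> {}"
    using pseudocompact_open_sequence_cluster[OF Y, of T] T by metis
  have SX: "S n \<subseteq> topspace X" and TY: "T n \<subseteq> topspace Y" for n
    using S T openin_subset by blast+
  have op: "openin X {x \<in> topspace X. f x y \<in> V}" if "y \<in> topspace Y" "open V" for y V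
    using openin_continuous_map_preimage[OF contX[OF that(1)]] that by simp
  have opY: "openin Y {y \<in> topspace Y. f x y \<in> V}" if "x \<in> topspace X" "open V" for x V
    using openin_continuous_map_preimage[OF contY[OF that(1)]] that by simp
  \<comment> \<open>With \<open>x\<close> in \<open>S n\<close> fixed, the bound \<open>lo\<close>
    covers every \<open>T m\<close> with \<open>m \<ge> Suc n\<close>, and such sets meet each
    neighbourhood of \<open>t\<close>.\<close>
  have lo_t: "f x t \<le> c" if x: "x \<in> S n" for x n
  proof (rule ccontr)
    assume "\<not> f x t \<le> c"
    then obtain m y where "m \<ge> Suc n" "y \<in> T m" "f x y > c"
      using t(2)[OF opY[of x "{c<..}"], of "Suc n"] t(1) x SX by auto
    then show False using lo[of n m x y] x by auto
  qed
  have hi_s: "d \<le> f s y" if y: "y \<in> T m" for y m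
  proof (rule ccontr)
    assume "\<not> d \<le> f s y"
    then obtain n x where "n \<ge> m" "x \<in> S n" "f x y < d"
      using s(2)[OF op[of y "{..<d}"], of m] s(1) y TY by auto
    then show False using hi[of m n x y] y by auto
  qed
  have "f s t \<le> c"
  proof (rule ccontr)
    assume "\<not> f s t \<le> c"
    then obtain n x where "x \<in> S n" "f x t > c"
      using s(2)[OF op[of t "{c<..}"], of 0] s(1) t(1) by auto
    then show False using lo_t[of x n] by auto
  qed
  moreover have "d \<le> f s t"
  proof (rule ccontr)
    assume "\<not> d \<le> f s t"
    then obtain m y where "y \<in> T m" "f s y < d"
      using t(2)[OF opY[of s "{..<d}"], of 0] s(1) t(1) by auto
    then show False using hi_s[of y m] by auto
  qed
  ultimately show ?thesis by simp
qed

text \<open>The open set supplied by quasicontinuity is shrunk to an open box around one of its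
  points. The box lies in \<open>A \<times> B\<close> but may miss \<open>(a, b)\<close>.\<close>

lemma quasicontinuous_map_prodE:
  assumes "quasicontinuous_map (prod_topology X Y) Z f"
    and "openin X A" "a \<in> A" "openin Y B" "b \<in> B" "openin Z V" "f (a, b) \<in> V"
  obtains A' B' where "openin X A'" "A' \<noteq> {}" "A' \<subseteq> A" "openin Y B'" "B' \<noteq> {}" "B' \<subseteq> B"
    and "\<And>x y. x \<in> A' \<Longrightarrow> y \<in> B' \<Longrightarrow> f (x, y) \<in> V"
proof -
  have "openin (prod_topology X Y) (A \<times> B)" "(a, b) \<in> A \<times> B"
    using assms(2-5) by (auto simp: openin_prod_Times_iff)
  moreover have "(a, b) \<in> topspace (prod_topology X Y)"
    using openin_subset[OF assms(2)] openin_subset[OF assms(4)] assms(3,5) by auto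
  ultimately obtain W where W: "openin (prod_topology X Y) W" "W \<noteq> {}" "W \<subseteq> A \<times> B" "f ` W \<subseteq> V"
    using assms(1,6,7) unfolding quasicontinuous_map_def by metis
  obtain u v where uv: "(u, v) \<in> W" using W(2) by auto
  obtain A' B' where "openin X A'" "openin Y B'" "u \<in> A'" "v \<in> B'" "A' \<times> B' \<subseteq> W"
    using W(1) uv unfolding openin_prod_topology_alt by meson
  then show thesis using W by (intro that[of A' B']) blast+
qed

section \<open>Multiplication on lower cones and on the whole semilattice\<close>

context semitopological_semilattice
begin

lemma mem_lower_cone: "y \<in> lower_cone mul x \<longleftrightarrow> mul x y = y"
  by (simp add: lower_cone_def natural_le_def)

lemma lower_cone_mul: "a \<in> lower_cone mul x \<Longrightarrow> mul a b \<in> lower_cone mul x"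
  by (metis mem_lower_cone assoc)

lemma open_vimage_mul: "open U \<Longrightarrow> open {y. mul a y \<in> U}"
  using continuous_left[of a] continuous_on_open_vimage[of UNIV] by (auto simp: vimage_def)

text \<open>One step of the recursion. A bad pair \<open>(a, b)\<close> near \<open>(x, x)\<close>
  is translated to \<open>(mul s a, mul t b)\<close>, whose product has \<phi>-value 1;
  quasicontinuity there gives \<open>A'\<close> and \<open>T\<close>. A second use, at a point of
  \<open>A'\<close> paired with \<open>t\<close>, gives \<open>S\<close> and \<open>B'\<close>. As
  \<open>S\<close> lies in \<open>A'\<close>, the pair \<open>A'\<close>, \<open>B'\<close> again
  has a small product and the step can be repeated.\<close>

lemma lower_cone_product_step:
  fixes x :: 'a and \<phi> :: "'a \<Rightarrow> real"
  defines "P \<equiv> lower_cone mul x"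
  assumes qc: "quasicontinuous_map (prod_topology (top_of_set P) (top_of_set P)) (top_of_set P)
                 (\<lambda>(a, b). mul a b)"
    and cont: "continuous_on UNIV \<phi>"
    and large: "\<And>y. y \<notin> V \<Longrightarrow> \<phi> y = 1"
    and upper: "\<And>y z. y \<in> P \<Longrightarrow> y \<notin> V \<Longrightarrow> mul z y \<notin> V"
    and bad: "\<And>U. open U \<Longrightarrow> x \<in> U \<Longrightarrow> \<exists>a\<in>U \<inter> P. \<exists>b\<in>U \<inter> P. mul a b \<notin> V"
    and A: "openin (top_of_set P) A" and B: "openin (top_of_set P) B"
    and st: "s \<in> A" "t \<in> B" "\<phi> (mul s t) < 1/3"
  obtains A' B' S T where "openin (top_of_set P) A'" "A' \<subseteq> A"
    and "openin (top_of_set P) B'" "B' \<subseteq> B" "B' \<noteq> {}"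
    and "openin (top_of_set P) S" "S \<subseteq> A'" "S \<noteq> {}"
    and "openin (top_of_set P) T" "T \<subseteq> B" "T \<noteq> {}"
    and "\<And>a b. a \<in> A' \<Longrightarrow> b \<in> T \<Longrightarrow> \<phi> (mul a b) > 2/3"
    and "\<And>a b. a \<in> S \<Longrightarrow> b \<in> B' \<Longrightarrow> \<phi> (mul a b) < 1/3"
proof -
  have op: "open {y. \<phi> y < 1/3}" "open {y. \<phi> y > 2/3}"
    using open_Collect_less[OF cont continuous_on_const] open_Collect_less[OF continuous_on_const cont]
    by blast+
  obtain A0 B0 where A0: "open A0" "A = P \<inter> A0" and B0: "open B0" "B = P \<inter> B0"
    using A B by (auto simp: openin_open)
  have sP: "s \<in> P" and tP: "t \<in> P" using st A0 B0 by auto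
  have sx: "mul s x = s" "mul t x = t"
    using sP tP by (auto simp: P_def mem_lower_cone commute)
  \<comment> \<open>All three conditions hold at \<open>u = x\<close> because \<open>x\<close> is
    the unit of the cone. The third one keeps \<open>mul (mul s a) t\<close> small.\<close>
  let ?U = "{u. mul s u \<in> A0} \<inter> {u. mul t u \<in> B0} \<inter> {u. mul (mul s t) u \<in> {y. \<phi> y < 1/3}}"
  have oU: "open ?U" using A0 B0 op by (intro open_Int open_vimage_mul) auto
  have xU: "x \<in> ?U" using sx st A0 B0 by (simp add: assoc)
  obtain a b where ab: "a \<in> ?U" "a \<in> P" "b \<in> ?U" "b \<in> P" "mul a b \<notin> V"
    using bad[OF oU xU] by blast
  have sa: "mul s a \<in> A" and tb: "mul t b \<in> B"
    using ab A0 B0 sP tP lower_cone_mul by (auto simp: P_def)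
  have "mul (mul s t) (mul a b) \<notin> V"
    using upper[of "mul a b"] ab lower_cone_mul by (auto simp: P_def)
  then have big: "\<phi> (mul (mul s a) (mul t b)) > 2/3"
    using large by (simp add: ac_simps)
  \<comment> \<open>Quasicontinuity may move away from \<open>mul s a\<close>. Shrinking
    \<open>A\<close> to \<open>A1\<close> beforehand ensures that every point of \<open>A'\<close>
    still has a small product with \<open>t\<close>.\<close>
  define A1 where "A1 = P \<inter> (A0 \<inter> {y. mul t y \<in> {y. \<phi> y < 1/3}})"
  have A1: "openin (top_of_set P) A1"
    unfolding A1_def using A0 op by (intro openin_open_Int open_Int open_vimage_mul) auto
  have saA1: "mul s a \<in> A1" using sa ab by (auto simp: A1_def A0 ac_simps)
  have oP: "openin (top_of_set P) (P \<inter> {y. \<phi> y > 2/3})" "openin (top_of_set P) (P \<inter> {y. \<phi> y < 1/3})"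
    using op by (auto intro: openin_open_Int)
  have "(\<lambda>(a, b). mul a b) (mul s a, mul t b) \<in> P \<inter> {y. \<phi> y > 2/3}"
    using big sP lower_cone_mul by (simp add: P_def)
  then obtain A' T where A': "openin (top_of_set P) A'" "A' \<noteq> {}" "A' \<subseteq> A1"
      and T: "openin (top_of_set P) T" "T \<noteq> {}" "T \<subseteq> B"
      and A'T: "\<And>a b. a \<in> A' \<Longrightarrow> b \<in> T \<Longrightarrow> (\<lambda>(a, b). mul a b) (a, b) \<in> P \<inter> {y. \<phi> y > 2/3}"
    using quasicontinuous_map_prodE[OF qc A1 saA1 B tb oP(1)] by metis
  obtain s' where s': "s' \<in> A'" using A' by blast
  then have "(\<lambda>(a, b). mul a b) (s', t) \<in> P \<inter> {y. \<phi> y < 1/3}"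
    using A' lower_cone_mul by (auto simp: A1_def P_def commute)
  then obtain S B' where S: "openin (top_of_set P) S" "S \<noteq> {}" "S \<subseteq> A'"
      and B': "openin (top_of_set P) B'" "B' \<noteq> {}" "B' \<subseteq> B"
      and SB': "\<And>a b. a \<in> S \<Longrightarrow> b \<in> B' \<Longrightarrow> (\<lambda>(a, b). mul a b) (a, b) \<in> P \<inter> {y. \<phi> y < 1/3}"
    using quasicontinuous_map_prodE[OF qc A'(1) s' B st(2) oP(2)] by metis
  have "A' \<subseteq> A" using A' by (auto simp: A1_def A0)
  then show thesis using that[of A' B' S T] A' T A'T S B' SB' by auto
qed

text \<open>If continuity failed at \<open>(x, x)\<close>, iterating
  \<open>lower_cone_product_step\<close> would produce sequences that violate the double limit
  lemma. The assumption \<open>upper\<close> says that the part of the cone outside \<open>V\<close>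
  is never left by moving down; this keeps bad products bad under translation.\<close>

lemma lower_cone_continuous_at_top:
  fixes x :: 'a
  defines "P \<equiv> lower_cone mul x"
  assumes cr: "completely_regular_space (euclidean :: 'a topology)"
    and pc: "pseudocompact_space (top_of_set P)"
    and qc: "quasicontinuous_map (prod_topology (top_of_set P) (top_of_set P)) (top_of_set P)
               (\<lambda>(a, b). mul a b)"
    and V: "open V" "x \<in> V"
    and upper: "\<And>y z. y \<in> P \<Longrightarrow> y \<notin> V \<Longrightarrow> mul z y \<notin> V"
  obtains U where "open U" "x \<in> U" "\<And>a b. a \<in> U \<inter> P \<Longrightarrow> b \<in> U \<inter> P \<Longrightarrow> mul a b \<in> V"
proof (rule ccontr)
  assume "\<not> thesis"
  then have bad: "\<exists>a\<in>U \<inter> P. \<exists>b\<in>U \<inter> P. mul a b \<notin> V" if "open U" "x \<in> U" for U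
    using that \<open>\<And>U. \<lbrakk>open U; x \<in> U; \<And>a b. \<lbrakk>a \<in> U \<inter> P; b \<in> U \<inter> P\<rbrakk> \<Longrightarrow> mul a b \<in> V\<rbrakk> \<Longrightarrow> thesis\<close>
    by metis
  have "closedin euclidean (- V)" "x \<in> topspace euclidean - (- V)" using V by auto
  then obtain \<phi> where \<phi>: "continuous_map euclidean (top_of_set {0..1::real}) \<phi>" "\<phi> x = 0"
      "\<phi> ` (- V) \<subseteq> {1}"
    using cr unfolding completely_regular_space_def by metis
  have cont: "continuous_on UNIV \<phi>"
    using \<phi>(1) by (simp add: continuous_map_in_subtopology)
  have large: "\<And>y. y \<notin> V \<Longrightarrow> \<phi> y = 1" using \<phi>(3) by auto
  \<comment> \<open>A state holds the current \<open>A\<close>, \<open>B\<close> and the last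
    \<open>S\<close>, \<open>T\<close> produced; the invariant \<open>I\<close> leaves
    \<open>S\<close> and \<open>T\<close> free. In \<open>R\<close>, the set \<open>T'\<close> lies
    in the old \<open>B\<close> but \<open>S'\<close> in the new \<open>A'\<close>, and this
    asymmetry separates the cases \<open>n < m\<close> and \<open>m \<le> n\<close> below.\<close>
  define I where "I = (\<lambda>(A, B, S :: 'a set, T :: 'a set).
      openin (top_of_set P) A \<and> openin (top_of_set P) B \<and> (\<exists>s\<in>A. \<exists>t\<in>B. \<phi> (mul s t) < 1/3))"
  define R where "R = (\<lambda>(A, B, S :: 'a set, T :: 'a set) (A', B', S', T').
      A' \<subseteq> A \<and> B' \<subseteq> B \<and> S' \<subseteq> A' \<and> T' \<subseteq> B \<and> S' \<noteq> {} \<and> T' \<noteq> {} \<and>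
      openin (top_of_set P) S' \<and> openin (top_of_set P) T' \<and>
      (\<forall>a\<in>A'. \<forall>b\<in>T'. \<phi> (mul a b) > 2/3) \<and> (\<forall>a\<in>S'. \<forall>b\<in>B'. \<phi> (mul a b) < 1/3))"
  have xP: "x \<in> P" by (simp add: P_def mem_lower_cone)
  have init: "I (P, P, {}, {})"
    using xP \<phi>(2) by (auto simp: I_def openin_subtopology_self intro!: bexI[of _ x])
  have next_ex: "\<exists>q'. I q' \<and> R q q'" if "I q" for q
  proof -
    obtain A B S0 T0 where q: "q = (A, B, S0, T0)" by (cases q)
    have "I (A, B, S0, T0)" using that q by simp
    then obtain s t where h: "openin (top_of_set P) A" "openin (top_of_set P) B"
        "s \<in> A" "t \<in> B" "\<phi> (mul s t) < 1/3"
      unfolding I_def prod.case by blast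
    show ?thesis
    proof (rule lower_cone_product_step[of x \<phi> V A B s t, folded P_def,
             OF qc cont large upper bad h])
      fix A' B' S T
      assume st: "openin (top_of_set P) A'" "A' \<subseteq> A"
        "openin (top_of_set P) B'" "B' \<subseteq> B" "B' \<noteq> {}"
        "openin (top_of_set P) S" "S \<subseteq> A'" "S \<noteq> {}"
        "openin (top_of_set P) T" "T \<subseteq> B" "T \<noteq> {}"
        "\<And>a b. a \<in> A' \<Longrightarrow> b \<in> T \<Longrightarrow> \<phi> (mul a b) > 2/3"
        "\<And>a b. a \<in> S \<Longrightarrow> b \<in> B' \<Longrightarrow> \<phi> (mul a b) < 1/3"
      obtain s' t' where s't': "s' \<in> S" "t' \<in> B'" using st(5,8) by blast
      then have "s' \<in> A'" "\<phi> (mul s' t') < 1/3" using st(7,13) by auto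
      then have "I (A', B', S, T)" using st(1,3) s't' unfolding I_def prod.case by blast
      moreover have "R q (A', B', S, T)"
        unfolding R_def q prod.case by (intro conjI ballI st)
      ultimately show "\<exists>q'. I q' \<and> R q q'" by blast
    qed
  qed
  have "\<exists>q. \<forall>n::nat. I (q n) \<and> R (q n) (q (Suc n))"
    by (rule dependent_nat_choice[of "\<lambda>_. I" "\<lambda>_. R"]) (rule exI[of I, OF init], rule next_ex)
  then obtain q where q: "\<And>n::nat. R (q n) (q (Suc n))" by blast
  define A where "A n = fst (q n)" for n
  define B where "B n = fst (snd (q n))" for n
  \<comment> \<open>The shift to \<open>Suc n\<close> skips the unconstrained third and fourth
    components of \<open>q 0\<close>.\<close>
  define S where "S n = fst (snd (snd (q (Suc n))))" for n
  define T where "T n = snd (snd (snd (q (Suc n))))" for n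
  have "R (A n, B n, fst (snd (snd (q n))), snd (snd (snd (q n)))) (A (Suc n), B (Suc n), S n, T n)"
    for n using q[of n] by (simp add: A_def B_def S_def T_def)
  then have step: "A (Suc n) \<subseteq> A n" "B (Suc n) \<subseteq> B n" "S n \<subseteq> A (Suc n)" "T n \<subseteq> B n"
      "S n \<noteq> {}" "T n \<noteq> {}" "openin (top_of_set P) (S n)" "openin (top_of_set P) (T n)"
      "\<forall>a\<in>A (Suc n). \<forall>b\<in>T n. \<phi> (mul a b) > 2/3"
      "\<forall>a\<in>S n. \<forall>b\<in>B (Suc n). \<phi> (mul a b) < 1/3" for n
    unfolding R_def prod.case by blast+
  have A_anti: "A n \<subseteq> A m" and B_anti: "B n \<subseteq> B m" if "m \<le> n" for m n
    using lift_Suc_antimono_le[of A, OF step(1) that] lift_Suc_antimono_le[of B, OF step(2) that]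
    by auto
  have crP: "completely_regular_space (top_of_set P)"
    using cr by (rule completely_regular_space_subtopology)
  have contR: "continuous_map (top_of_set P) euclideanreal (\<lambda>b. \<phi> (mul a b))" for a
    using continuous_on_subset[OF continuous_on_compose2[OF cont continuous_left[of a]], of P]
    by simp
  have contL: "continuous_map (top_of_set P) euclideanreal (\<lambda>a. \<phi> (mul a b))" for b
    using contR[of b] by (simp add: commute)
  \<comment> \<open>For \<open>n < m\<close>, \<open>T m\<close> lies in \<open>B m\<close> and
    hence in \<open>B (Suc n)\<close>, where products with \<open>S n\<close> are small. For
    \<open>m \<le> n\<close>, \<open>S n\<close> lies in \<open>A (Suc n)\<close> and hence in
    \<open>A (Suc m)\<close>, where products with \<open>T m\<close> are large.\<close>
  have "(2/3::real) \<le> 1/3"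
  proof (rule pseudocompact_double_limit[where f = "\<lambda>a b. \<phi> (mul a b)",
           OF crP pc crP pc contL contR step(7,5,8,6)])
    fix n m a b
    assume "n < m" "a \<in> S n" "b \<in> T m"
    then have "a \<in> S n" "b \<in> B (Suc n)" using step(4)[of m] B_anti[of "Suc n" m] by auto
    then show "\<phi> (mul a b) \<le> 1/3" using step(10)[of n] by (intro less_imp_le) blast
  next
    fix n m a b
    assume "m \<le> n" "a \<in> S n" "b \<in> T m"
    then have "a \<in> A (Suc m)" "b \<in> T m" using step(3)[of n] A_anti[of "Suc m" "Suc n"] by auto
    then show "2/3 \<le> \<phi> (mul a b)" using step(9)[of m] by (intro less_imp_le) blast
  qed
  then show False by simp
qed

text \<open>Convexity of \<open>V\<close> serves twice: it yields the assumption
  \<open>upper\<close> for the cone, and it carries continuity from the cone back to the whole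
  space.\<close>

lemma continuous_at_diagonal:
  assumes cr: "completely_regular_space (euclidean :: 'a topology)"
    and lc: "locally_order_convex (natural_le mul)"
    and pc: "pseudocompact_space (top_of_set (lower_cone mul x))"
    and qc: "quasicontinuous_map
           (prod_topology (top_of_set (lower_cone mul x)) (top_of_set (lower_cone mul x)))
           (top_of_set (lower_cone mul x)) (\<lambda>(a, b). mul a b)"
  shows "topcontinuous_at (prod_topology euclidean euclidean) euclidean (\<lambda>(a, b). mul a b) (x, x)"
  unfolding topcontinuous_at_def
proof (intro conjI allI impI)
  fix V0 assume V0: "openin euclidean V0 \<and> (case (x, x) of (a, b) \<Rightarrow> mul a b) \<in> V0"
  then have "open V0" "x \<in> V0" by auto
  then obtain V where V: "open V" "x \<in> V" "V \<subseteq> V0" "order_convex (natural_le mul) V"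
    using lc unfolding locally_order_convex_def by (metis topological_basisE topological_basis_open)
  have conv: "c \<in> V" if "a \<in> V" "b \<in> V" "mul c a = a" "mul b c = c" for a b c
    using V(4) that unfolding order_convex_def natural_le_def by blast
  \<comment> \<open>Otherwise \<open>y\<close> would lie between the points \<open>mul z y\<close>
    and \<open>x\<close> of the convex set \<open>V\<close>.\<close>
  have upper: "mul z y \<notin> V" if "y \<in> lower_cone mul x" "y \<notin> V" for y z
    using conv[of "mul z y" x y] V(2) that
    by (metis mem_lower_cone left_idem commute)
  obtain U where U: "open U" "x \<in> U"
      "\<And>a b. a \<in> U \<inter> lower_cone mul x \<Longrightarrow> b \<in> U \<inter> lower_cone mul x \<Longrightarrow> mul a b \<in> V"
    using lower_cone_continuous_at_top[OF cr pc qc V(1,2) upper] by blast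
  \<comment> \<open>The factor \<open>V\<close> makes \<open>a\<close> an upper bound in
    \<open>V\<close> for \<open>mul a b\<close>; the second factor puts the lower bound
    \<open>mul x (mul a b)\<close> in \<open>V\<close>.\<close>
  define W where "W = V \<inter> {a. mul x a \<in> U}"
  have "open W" unfolding W_def using V U by (intro open_Int open_vimage_mul)
  moreover have "x \<in> W" using V U by (simp add: W_def)
  moreover have "mul a b \<in> V0" if "a \<in> W" "b \<in> W" for a b
  proof -
    have "mul x a \<in> U \<inter> lower_cone mul x" "mul x b \<in> U \<inter> lower_cone mul x"
      using that by (auto simp: W_def mem_lower_cone)
    then have "mul (mul x a) (mul x b) \<in> V" by (rule U(3))
    moreover have "mul (mul x a) (mul x b) = mul x (mul a b)" by (metis assoc commute idem)
    ultimately have "mul a b \<in> V"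
      using conv[of "mul x (mul a b)" a "mul a b"] that
      by (simp add: W_def) (metis left_idem commute)
    then show ?thesis using V by blast
  qed
  ultimately show "\<exists>U. openin (prod_topology euclidean euclidean) U \<and> (x, x) \<in> U \<and>
      (\<forall>y\<in>U. (case y of (a, b) \<Rightarrow> mul a b) \<in> V0)"
    by (intro exI[of _ "W \<times> W"]) (auto simp: open_Times)
qed auto

end

theorem theorem6p3:
  fixes mul :: "'a::topological_space \<Rightarrow> 'a \<Rightarrow> 'a"
  assumes "semitopological_semilattice mul"
    and "tychonoff_space (euclidean :: 'a topology)"
    and "locally_order_convex (natural_le mul)"
    and "\<And>x. pseudocompact_space (top_of_set (lower_cone mul x))"
    and "\<And>x. quasicontinuous_map
           (prod_topology (top_of_set (lower_cone mul x)) (top_of_set (lower_cone mul x)))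
           (top_of_set (lower_cone mul x))
           (\<lambda>(a, b). mul a b)"
  shows "\<forall>x. topcontinuous_at (prod_topology euclidean euclidean) euclidean
           (\<lambda>(a, b). mul a b) (x, x)"
proof
  fix x
  have cr: "completely_regular_space (euclidean :: 'a topology)"
    using assms(2) unfolding tychonoff_space_def by (rule conjunct1)
  show "topcontinuous_at (prod_topology euclidean euclidean) euclidean
           (\<lambda>(a, b). mul a b) (x, x)"
    by (rule semitopological_semilattice.continuous_at_diagonal
        [OF assms(1) cr assms(3) assms(4)[of x] assms(5)[of x]])
qed

end
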